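(* Let $f_{33}$, $y_{\beta_1}$, $y_{\beta_2}$, $\vartheta_q$ be as defined in the context. Then $$f_{33}(x)=\frac{\check S_1+A_{1,2}K_{6,3}}{A_{1,1}}\,y_{\beta_1}(x)-\frac{A_{1,2}}{A_{1,1}}\,y_{\beta_2}(x),$$ where $$A_{1,1}=\frac{(\beta_1/\alpha_1,\alpha_2/\beta_2,q^{-\lambda}\beta_2/\alpha_1;q)_\infty}{(q^\lambda\alpha_2/\beta_2,\beta_2/\alpha_1,q^{-\lambda}\beta_1/\alpha_1;q)_\infty},$$ $$A_{1,2}=-\frac{\beta_2^{-\lambda+\mu'}}{1-q}\,\frac{(q^{-\lambda}\beta_2/\alpha_1,q^\lambda\alpha_1\alpha_2/(\beta_1\beta_2),q\beta_2/\alpha_2,\beta_1/\alpha_1,\alpha_2/\beta_2;q)_\infty}{(q^\lambda\alpha_2/\beta_2,\alpha_2/\beta_1,q^{-\lambda}\beta_1/\alpha_1,q^{\lambda+1}\alpha_1/\beta_1,q;q)_\infty},$$ $$K_{6,3}=-\left(\frac{\beta_2}{\beta_1}\right)^{\lambda-\mu'}\frac{\vartheta_q(\beta_1/\beta_2)\,\vartheta_q(\alpha_2/\beta_1)\,\vartheta_q(q^\lambda\alpha_1/\beta_1)}{\vartheta_q(\beta_2/\beta_1)\,\vartheta_q(\alpha_2/\beta_2)\,\vartheta_q(q^\lambda\alpha_1/\beta_2)},$$ $$\check S_1=\frac{\beta_1^{-\lambda+\mu'}}{1-q}\,\frac{(q^\lambda\alpha_1\alpha_2/(\beta_1\beta_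2),\beta_1/\alpha_1,q\beta_1/\alpha_2;q)_\infty}{(q^{\lambda+1}\alpha_1/\beta_2,q^\lambda\alpha_2/\beta_2,q;q)_\infty}.$$
   Context: $q$ is a complex number with $0<|q|<1$. Notation: $(a;q)_n=\prod_{j=0}^{n-1}(1-q^ja)$, $(a;q)_\infty=\prod_{j=0}^\infty(1-q^ja)$, $(a_1,\dots,a_N;q)_n=\prod_i(a_i;q)_n$ (also for $n=\infty$), $\vartheta_q(t)=(t,q/t,q;q)_\infty$, and $${}_3\phi_2\left(\begin{array}{c}a_1,a_2,a_3\\ b_1,b_2\end{array};q,z\right)=\sum_{n=0}^\infty\frac{(a_1,a_2,a_3;q)_n}{(q;q)_n(b_1,b_2;q)_n}z^n.$$ $\alpha_1,\alpha_2,\beta_1,\beta_2\in\mathbb{C}\setminus\{0\}$, $\lambda,\mu'\in\mathbb{C}$ with $q^{\mu'}\alpha_1\alpha_2/(\beta_1\beta_2)=1$. Parameters are generic, so that no denominator vanishes, and the series are assumed convergent: $|q^\lambda\alpha_1\alpha_2/(\beta_1\beta_2)|<1$ and $|\alpha_2/\beta_1|<1$. Values of $\log q,\log\beta_1,\log\beta_2,\log x$ are fixed, $t^s=\exp(s\log t)$ and $(\beta_2/\beta_1)^s=\beta_2^s/\beta_1^s$. $$y_{\beta_1}(x)=(1-q)\beta_1^{\lambda-\mu'}x^\lambda\frac{(\beta_1x,q,q\beta_1/\beta_2;q)_\infty}{(q^{-\lambda}\beta_1x,\beta_1/\alpha_1,q\beta_1/\alpha_2;q)_\infty}\,{}_3\phi_2\left(\begin{array}{c}q^{-\lambda}\beta_1x,\beta_1/\alpha_1,q\beta_1/\alpha_2\\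 \beta_1x,q\beta_1/\beta_2\end{array};q,q^\lambda\frac{\alpha_1\alpha_2}{\beta_1\beta_2}\right),$$ $$y_{\beta_2}(x)=(1-q)\beta_2^{\lambda-\mu'}x^\lambda\frac{(\beta_2x,q,q\beta_2/\beta_1;q)_\infty}{(q^{-\lambda}\beta_2x,\beta_2/\alpha_1,q\beta_2/\alpha_2;q)_\infty}\,{}_3\phi_2\left(\begin{array}{c}q^{-\lambda}\beta_2x,\beta_2/\alpha_1,q\beta_2/\alpha_2\\ \beta_2x,q\beta_2/\beta_1\end{array};q,q^\lambda\frac{\alpha_1\alpha_2}{\beta_1\beta_2}\right),$$ $$f_{33}(x)=x^\lambda\frac{(\beta_2x;q)_\infty}{(q^{-\lambda}\beta_2x;q)_\infty}\,{}_3\phi_2\left(\begin{array}{c}q\beta_2/\alpha_2,q^\lambda,\alpha_1x\\ q^{\lambda+1}\alpha_1/\beta_1,\beta_2x\end{array};q,\frac{\alpha_2}{\beta_1}\right).$$ *)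

theory Defs
  imports "HOL-Analysis.Analysis"
begin

definition qpoch :: "complex list \<Rightarrow> complex \<Rightarrow> nat \<Rightarrow> complex" where
  "qpoch as q n = (\<Prod>a\<leftarrow>as. \<Prod>j<n. 1 - q ^ j * a)"

definition qpoch_inf :: "complex list \<Rightarrow> complex \<Rightarrow> complex" where
  "qpoch_inf as q = (\<Prod>a\<leftarrow>as. \<Prod>j. 1 - q ^ j * a)"

definition qtheta :: "complex \<Rightarrow> complex \<Rightarrow> complex" where
  "qtheta q t = qpoch_inf [t, q / t, q] q"

definition phi32 ::
  "complex \<Rightarrow> complex \<Rightarrow> complex \<Rightarrow> complex \<Rightarrow> complex \<Rightarrow> complex \<Rightarrow> complex \<Rightarrow> complex" where
  "phi32 a1 a2 a3 b1 b2 q z =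
     (\<Sum>n. qpoch [a1, a2, a3] q n / (qpoch [q] q n * qpoch [b1, b2] q n) * z ^ n)"

text \<open>
  Complex powers depend on a chosen value of the logarithm: if \<open>l\<close> is the fixed value of
  \<open>log t\<close>, then \<open>t\<^sup>s\<close> is \<open>lpow l s\<close>. Throughout, \<open>lq\<close>, \<open>lb1\<close>, \<open>lb2\<close>, \<open>lx\<close> are the fixed
  (arbitrary, not necessarily principal) values of the logarithms of \<open>q\<close>, \<open>\<beta>1\<close>, \<open>\<beta>2\<close>, \<open>x\<close>.
  The paper's parameters \<open>\<lambda>\<close>, \<open>\<mu>'\<close> are written \<open>lam\<close>, \<open>mu'\<close>.
\<close>

definition lpow :: "complex \<Rightarrow> complex \<Rightarrow> complex" where
  "lpow l s = exp (s * l)"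

definition y_b1 where
  "y_b1 q lq \<alpha>1 \<alpha>2 \<beta>1 \<beta>2 lb1 lam mu' x lx =
     (1 - q) * lpow lb1 (lam - mu') * lpow lx lam
     * (qpoch_inf [\<beta>1 * x, q, q * \<beta>1 / \<beta>2] q
        / qpoch_inf [lpow lq (-lam) * \<beta>1 * x, \<beta>1 / \<alpha>1, q * \<beta>1 / \<alpha>2] q)
     * phi32 (lpow lq (-lam) * \<beta>1 * x) (\<beta>1 / \<alpha>1) (q * \<beta>1 / \<alpha>2)
             (\<beta>1 * x) (q * \<beta>1 / \<beta>2)
             q (lpow lq lam * (\<alpha>1 * \<alpha>2 / (\<beta>1 * \<beta>2)))"

definition y_b2 where
  "y_b2 q lq \<alpha>1 \<alpha>2 \<beta>1 \<beta>2 lb2 lam mu' x lx =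
     (1 - q) * lpow lb2 (lam - mu') * lpow lx lam
     * (qpoch_inf [\<beta>2 * x, q, q * \<beta>2 / \<beta>1] q
        / qpoch_inf [lpow lq (-lam) * \<beta>2 * x, \<beta>2 / \<alpha>1, q * \<beta>2 / \<alpha>2] q)
     * phi32 (lpow lq (-lam) * \<beta>2 * x) (\<beta>2 / \<alpha>1) (q * \<beta>2 / \<alpha>2)
             (\<beta>2 * x) (q * \<beta>2 / \<beta>1)
             q (lpow lq lam * (\<alpha>1 * \<alpha>2 / (\<beta>1 * \<beta>2)))"

definition f33 where
  "f33 q lq \<alpha>1 \<alpha>2 \<beta>1 \<beta>2 lam x lx =
     lpow lx lam
     * (qpoch_inf [\<beta>2 * x] q / qpoch_inf [lpow lq (-lam) * \<beta>2 * x] q)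
     * phi32 (q * \<beta>2 / \<alpha>2) (lpow lq lam) (\<alpha>1 * x)
             (lpow lq (lam + 1) * \<alpha>1 / \<beta>1) (\<beta>2 * x)
             q (\<alpha>2 / \<beta>1)"

definition A11 where
  "A11 q lq \<alpha>1 \<alpha>2 \<beta>1 \<beta>2 lam =
     qpoch_inf [\<beta>1 / \<alpha>1, \<alpha>2 / \<beta>2, lpow lq (-lam) * \<beta>2 / \<alpha>1] q
     / qpoch_inf [lpow lq lam * \<alpha>2 / \<beta>2, \<beta>2 / \<alpha>1, lpow lq (-lam) * \<beta>1 / \<alpha>1] q"

definition A12 where
  "A12 q lq \<alpha>1 \<alpha>2 \<beta>1 \<beta>2 lb2 lam mu' =
     - (lpow lb2 (-lam + mu') / (1 - q))
     * (qpoch_inf [lpow lq (-lam) * \<beta>2 / \<alpha>1, lpow lq lam * \<alpha>1 * \<alpha>2 / (\<beta>1 * \<beta>2),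
                   q * \<beta>2 / \<alpha>2, \<beta>1 / \<alpha>1, \<alpha>2 / \<beta>2] q
        / qpoch_inf [lpow lq lam * \<alpha>2 / \<beta>2, \<alpha>2 / \<beta>1, lpow lq (-lam) * \<beta>1 / \<alpha>1,
                     lpow lq (lam + 1) * \<alpha>1 / \<beta>1, q] q)"

definition K63 where
  "K63 q lq \<alpha>1 \<alpha>2 \<beta>1 \<beta>2 lb1 lb2 lam mu' =
     - (lpow lb2 (lam - mu') / lpow lb1 (lam - mu'))
     * (qtheta q (\<beta>1 / \<beta>2) * qtheta q (\<alpha>2 / \<beta>1) * qtheta q (lpow lq lam * \<alpha>1 / \<beta>1)
        / (qtheta q (\<beta>2 / \<beta>1) * qtheta q (\<alpha>2 / \<beta>2) * qtheta q (lpow lq lam * \<alpha>1 / \<beta>2)))"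

definition S1_check where
  "S1_check q lq \<alpha>1 \<alpha>2 \<beta>1 \<beta>2 lb1 lam mu' =
     lpow lb1 (-lam + mu') / (1 - q)
     * (qpoch_inf [lpow lq lam * \<alpha>1 * \<alpha>2 / (\<beta>1 * \<beta>2), \<beta>1 / \<alpha>1, q * \<beta>1 / \<alpha>2] q
        / qpoch_inf [lpow lq (lam + 1) * \<alpha>1 / \<beta>2, lpow lq lam * \<alpha>2 / \<beta>2, q] q)"

end

theory Submission
  imports Defs
begin

text \<open>
  The claimed three-term relation is a two-term relation: the coefficient of \<open>y\<^sub>\<beta>\<^sub>1\<close> is zero.
  Indeed \<open>\<vartheta>(s) = -s (q s, 1/s, q; q)\<^sub>\<infinity>\<close> for every \<open>s \<noteq> 0\<close> (lemma \<open>qtheta_eq\<close>). Applied to the theta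
  quotients with arguments \<open>\<beta>\<^sub>1/\<beta>\<^sub>2\<close> and \<open>q\<^sup>\<lambda> \<alpha>\<^sub>1/\<beta>\<^sub>i\<close> in \<open>K\<^sub>6\<^sub>,\<^sub>3\<close>, it reduces \<open>A\<^sub>1\<^sub>,\<^sub>2 K\<^sub>6\<^sub>,\<^sub>3\<close> to \<open>-S\<^sub>1\<close>: the
  monomial prefactors cancel, and each of the remaining infinite products meets its counterpart
  in \<open>A\<^sub>1\<^sub>,\<^sub>2\<close>.

  What remains, \<open>f\<^sub>3\<^sub>3 = -(A\<^sub>1\<^sub>,\<^sub>2 / A\<^sub>1\<^sub>,\<^sub>1) y\<^sub>\<beta>\<^sub>2\<close>, is the classical transformation
  \<open>\<^sub>3\<phi>\<^sub>2(a, b, c; d, e; de/abc) = (e/a, de/bc; q)\<^sub>\<infinity> / (e, de/abc; q)\<^sub>\<infinity> \<cdot> \<^sub>3\<phi>\<^sub>2(a, d/b, d/c; d, de/bc; e/a)\<close>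
  at \<open>a = q\<beta>\<^sub>2/\<alpha>\<^sub>2\<close>, \<open>b = q\<^sup>\<lambda>\<close>, \<open>c = \<alpha>\<^sub>1 x\<close>, \<open>d = \<beta>\<^sub>2 x\<close>, \<open>e = q\<^sup>\<lambda>\<^sup>+\<^sup>1 \<alpha>\<^sub>1/\<beta>\<^sub>1\<close>; both arguments lie in the unit disc
  by the two convergence hypotheses. Lemma \<open>phi32_transformation\<close> obtains it by evaluating one
  absolutely convergent double series in two ways: its diagonals are Saalschuetz sums
  (\<open>q_saalschuetz\<close>), and its rows are Gauss sums (\<open>q_gauss\<close>). Each of these two summation formulas
  is derived from a \<open>q\<close>-difference equation.
\<close>

section \<open>Finite and infinite q-shifted factorials\<close>

lemma qpoch_Cons: "qpoch (a # b # as) q n = qpoch [a] q n * qpoch (b # as) q n"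
  by (simp add: qpoch_def)
lemma qpoch_inf_Cons: "qpoch_inf (a # b # as) q = qpoch_inf [a] q * qpoch_inf (b # as) q"
  by (simp add: qpoch_inf_def)

lemma qpoch_0 [simp]: "qpoch [a] q 0 = 1" by (simp add: qpoch_def)
lemma qpoch_Suc: "qpoch [a] q (Suc n) = (1 - q ^ n * a) * qpoch [a] q n"
  by (simp add: qpoch_def)

lemma qpoch_add: "qpoch [a] q (n + m) = qpoch [a] q n * qpoch [a * q ^ n] q m"
  by (induction m) (auto simp: qpoch_Suc power_add algebra_simps)

locale q_in_punctured_disc =
  fixes q :: complex
  assumes q_pos: "0 < norm q" and q_lt_1: "norm q < 1"
begin

lemma q_nonzero: "q \<noteq> 0" using q_pos by auto

lemma q_power_neq_1: "1 - q ^ Suc n \<noteq> 0"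
proof
  assume "1 - q ^ Suc n = 0"
  hence "norm (q ^ Suc n) = 1" by (metis norm_one right_minus_eq)
  moreover have "norm (q ^ Suc n) < 1" 
    using q_lt_1 q_pos by (metis norm_power power_Suc_less_one)
  ultimately show False by simp
qed

lemma norm_mult_q_power_le: "norm (a * q ^ n) \<le> norm a"
  using q_lt_1 by (simp add: norm_mult norm_power mult_left_le power_le_one)

lemma qpoch_nonzero:
  assumes "norm a < 1"
  shows "qpoch [a] q n \<noteq> 0"
proof (induction n)
  case (Suc n)
  have "norm (a * q ^ n) < 1" using norm_mult_q_power_le[of a n] assms by simp
  hence "1 - q ^ n * a \<noteq> 0" by (auto simp: mult.commute)
  thus ?case using Suc by (simp add: qpoch_Suc)
qed auto

lemmas qpoch_q_nonzero = qpoch_nonzero[OF q_lt_1]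

lemma convergent_qpoch: "convergent_prod (\<lambda>j. 1 - q ^ j * a)"
proof (rule abs_convergent_prod_imp_convergent_prod)
  have "summable (\<lambda>j. norm q ^ j * norm a)"
    using q_lt_1 by (intro summable_mult2 summable_geometric) auto
  thus "abs_convergent_prod (\<lambda>j. 1 - q ^ j * a)"
    by (simp add: abs_convergent_prod_conv_summable norm_mult norm_power)
qed

lemma qpoch_tendsto: "(\<lambda>n. qpoch [a] q n) \<longlonglongrightarrow> qpoch_inf [a] q"
  using convergent_prod_LIMSEQ[OF convergent_qpoch, of a]
  by (simp add: qpoch_def qpoch_inf_def LIMSEQ_lessThan_iff_atMost)

lemma qpoch_inf_split: "qpoch_inf [a] q = qpoch [a] q n * qpoch_inf [a * q ^ n] q"
proof (rule LIMSEQ_unique)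
  show "(\<lambda>m. qpoch [a] q (n + m)) \<longlonglongrightarrow> qpoch_inf [a] q"
    using LIMSEQ_ignore_initial_segment[OF qpoch_tendsto, of a n] by (simp add: add.commute)
  show "(\<lambda>m. qpoch [a] q (n + m)) \<longlonglongrightarrow> qpoch [a] q n * qpoch_inf [a * q ^ n] q"
    unfolding qpoch_add by (intro tendsto_intros qpoch_tendsto)
qed

lemma qpoch_inf_step: "qpoch_inf [a] q = (1 - a) * qpoch_inf [q * a] q"
  using qpoch_inf_split[of a 1] by (simp add: qpoch_Suc mult.commute)

lemma qpoch_inf_nonzero:
  assumes "\<And>n. qpoch [a] q n \<noteq> 0"
  shows "qpoch_inf [a] q \<noteq> 0"
proof -
  have "1 - q ^ n * a \<noteq> 0" for n using assms[of "Suc n"] by (simp add: qpoch_Suc)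
  thus ?thesis using prodinf_nonzero[OF convergent_qpoch, of a] by (simp add: qpoch_inf_def)
qed

text \<open>
  The bound depends on \<open>a\<close> only through an upper bound for its modulus and does not depend on \<open>n\<close>.
  It therefore passes to the infinite product, it bounds all factors \<open>(a q\<^sup>k; q)\<^sub>n\<close> simultaneously,
  and it tends to \<open>0\<close> with \<open>R\<close>, which gives continuity of the infinite product at \<open>a = 0\<close>.
\<close>
lemma norm_qpoch_minus_1:
  assumes "norm a \<le> R"
  shows "norm (qpoch [a] q n - 1) \<le> exp (R / (1 - norm q)) - 1"
proof -
  have "norm (qpoch [a] q n - 1) \<le> (\<Prod>j<n. 1 + norm q ^ j * norm a) - 1"
    using norm_prod_minus1_le_prod_minus1[of "\<lambda>j. - (q ^ j * a)" "{..<n}"]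
    by (simp add: qpoch_def norm_mult norm_power)
  also have "(\<Prod>j<n. 1 + norm q ^ j * norm a) \<le> exp (\<Sum>j<n. norm q ^ j * norm a)"
    by (rule prod_le_exp_sum) auto
  also have "(\<Sum>j<n. norm q ^ j * norm a) = (\<Sum>j<n. norm q ^ j) * norm a"
    by (simp add: sum_distrib_right)
  also have "\<dots> \<le> 1 / (1 - norm q) * R"
  proof (rule mult_mono)
    have "(\<Sum>j<n. norm q ^ j) \<le> (\<Sum>j. norm q ^ j)"
      using q_lt_1 by (intro sum_le_suminf summable_geometric) auto
    thus "(\<Sum>j<n. norm q ^ j) \<le> 1 / (1 - norm q)"
      using q_lt_1 by (simp add: suminf_geometric)
  qed (use assms q_lt_1 in auto)
  finally show ?thesis by simp
qed

lemma norm_qpoch_inf_minus_1: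
  assumes "norm a \<le> R"
  shows "norm (qpoch_inf [a] q - 1) \<le> exp (R / (1 - norm q)) - 1"
  by (rule Lim_norm_ubound[OF _ tendsto_diff[OF qpoch_tendsto tendsto_const]])
     (auto intro!: always_eventually norm_qpoch_minus_1 assms)

lemma norm_qpoch_le:
  assumes "norm a \<le> R"
  shows "norm (qpoch [a] q n) \<le> exp (R / (1 - norm q))"
  using norm_qpoch_minus_1[OF assms, of n] norm_triangle_ineq2[of "qpoch [a] q n" 1] by simp

lemma norm_qpoch_inf_le:
  assumes "norm a \<le> R"
  shows "norm (qpoch_inf [a] q) \<le> exp (R / (1 - norm q))"
  using norm_qpoch_inf_minus_1[OF assms] norm_triangle_ineq2[of "qpoch_inf [a] q" 1] by simp

lemma qpoch_inf_tendsto_1: "(\<lambda>n. qpoch_inf [a * q ^ n] q) \<longlonglongrightarrow> 1"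
proof -
  have "(\<lambda>n. norm (a * q ^ n)) \<longlonglongrightarrow> norm a * 0"
    unfolding norm_mult norm_power using q_lt_1 by (intro tendsto_intros LIMSEQ_power_zero) auto
  hence "(\<lambda>n. exp (norm (a * q ^ n) / (1 - norm q)) - 1) \<longlonglongrightarrow> exp (norm a * 0 / (1 - norm q)) - 1"
    using q_lt_1 by (intro tendsto_intros) auto
  hence "(\<lambda>n. exp (norm (a * q ^ n) / (1 - norm q)) - 1) \<longlonglongrightarrow> 0" by simp
  hence "(\<lambda>n. qpoch_inf [a * q ^ n] q - 1) \<longlonglongrightarrow> 0"
    by (rule Lim_null_comparison[OF always_eventually, rotated]) (auto intro: norm_qpoch_inf_minus_1)
  thus ?thesis by (simp add: LIM_zero_iff)
qed

text \<open>
  If no factor vanishes, the finite products converge to a nonzero limit, so they stay away from \<open>0\<close>.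
  This is how the denominators of hypergeometric terms are estimated.
\<close>
lemma inverse_qpoch_bounded:
  assumes "\<And>n. qpoch [a] q n \<noteq> 0"
  obtains K where "\<And>n. norm (inverse (qpoch [a] q n)) \<le> K" "0 < K"
proof -
  have "(\<lambda>n. inverse (qpoch [a] q n)) \<longlonglongrightarrow> inverse (qpoch_inf [a] q)"
    by (intro tendsto_inverse qpoch_tendsto qpoch_inf_nonzero assms)
  hence "Bseq (\<lambda>n. inverse (qpoch [a] q n))"
    by (intro convergent_imp_Bseq convergentI)
  thus thesis using that by (elim BseqE) blast
qed

section \<open>The Gauss sum for basic hypergeometric series\<close>

text \<open>
  The summand of \<open>(C; q)\<^sub>\<infinity> \<cdot> \<^sub>2\<phi>\<^sub>1(A, B; C; q, z)\<close> at \<open>C = A B z\<close>, the argument at which the series can be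
  summed. Merging \<open>(C; q)\<^sub>\<infinity> / (C; q)\<^sub>n\<close> into \<open>(C q\<^sup>n; q)\<^sub>\<infinity>\<close> removes every condition on \<open>C\<close> and makes
  \<open>A = 0\<close> and \<open>B = 0\<close> admissible.
\<close>
definition gauss_term where
  "gauss_term A B z n =
     qpoch [A] q n * qpoch [B] q n / qpoch [q] q n * qpoch_inf [A * B * z * q ^ n] q * z ^ n"

text \<open>
  The constant is uniform for all arguments in the disc of radius \<open>\<bar>z\<bar>\<close>, as needed for
  dominated convergence along \<open>z, q z, q\<^sup>2 z, \<dots>\<close>.
\<close>
lemma gauss_term_bound:
  fixes A B z :: complex
  obtains K where "\<And>y n. norm y \<le> norm z \<Longrightarrow> norm (gauss_term A B y n) \<le> K * norm y ^ n"
proof -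
  obtain K where K: "\<And>n. norm (inverse (qpoch [q] q n)) \<le> K" "0 < K"
    using inverse_qpoch_bounded[OF qpoch_q_nonzero] by blast
  let ?E = "\<lambda>a. exp (norm a / (1 - norm q))"
  have "norm (gauss_term A B y n) \<le> (?E A * ?E B * K * ?E (A * B * z)) * norm y ^ n"
    if y: "norm y \<le> norm z" for y n
  proof -
    have "norm (A * B * y * q ^ n) \<le> norm (A * B * y)" by (rule norm_mult_q_power_le)
    also have "\<dots> \<le> norm (A * B * z)" using y by (simp add: norm_mult mult_left_mono)
    finally have le: "norm (A * B * y * q ^ n) \<le> norm (A * B * z)" .
    have "gauss_term A B y n = qpoch [A] q n * qpoch [B] q n * inverse (qpoch [q] q n)
        * qpoch_inf [A * B * y * q ^ n] q * y ^ n"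
      by (simp add: gauss_term_def divide_inverse)
    also have "norm \<dots> = norm (qpoch [A] q n) * norm (qpoch [B] q n) * norm (inverse (qpoch [q] q n))
        * norm (qpoch_inf [A * B * y * q ^ n] q) * norm y ^ n"
      by (simp only: norm_mult norm_power)
    also have "\<dots> \<le> ?E A * ?E B * K * ?E (A * B * z) * norm y ^ n"
      by (intro mult_mono norm_qpoch_le norm_qpoch_inf_le K(1))
         (use le K(2) in auto)
    finally show ?thesis .
  qed
  thus thesis by (rule that)
qed

lemma gauss_term_summable:
  assumes "norm z < 1"
  shows "summable (\<lambda>n. norm (gauss_term A B z n))"
proof -
  obtain K where K: "\<And>y n. norm y \<le> norm z \<Longrightarrow> norm (gauss_term A B y n) \<le> K * norm y ^ n"
    using gauss_term_bound[where A = A and B = B and z = z] by metis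
  have "summable (\<lambda>n. K * norm z ^ n)"
    using assms by (intro summable_mult summable_geometric) auto
  thus ?thesis
    by (rule summable_comparison_test'[where N = 0]) (simp add: K)
qed

text \<open>
  First-order \<open>q\<close>-difference equation of the Gauss sum, by creative telescoping: the difference of
  the two sides is termwise \<open>G (n + 1) - G n\<close> with the certificate \<open>G n = -(1 - q\<^sup>n) t\<^sub>n\<close>, where \<open>t\<^sub>n\<close>
  is the summand. \<open>G\<close> vanishes at \<open>0\<close> and at infinity.
\<close>
lemma gauss_sum_step:
  assumes z: "norm z < 1"
  shows "(1 - z) * (\<Sum>n. gauss_term A B z n)
       = (1 - A * z) * (1 - B * z) * (\<Sum>n. gauss_term A B (q * z) n)"
proof -
  have qz: "norm (q * z) < 1"
    using mult_strict_mono[of "norm q" 1 "norm z" 1] q_lt_1 z by (simp add: norm_mult)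
  define G where "G n = (if n = 0 then 0 else - (1 - q ^ n) * gauss_term A B z n)" for n
  have G: "G n = - (1 - q ^ n) * gauss_term A B z n" for n by (simp add: G_def)
  have step: "(1 - z) * gauss_term A B z n - (1 - A * z) * (1 - B * z) * gauss_term A B (q * z) n
      = G (Suc n) - G n" for n
  proof -
    \<comment> \<open>After division by \<open>p\<close>, all terms are polynomials in \<open>q\<^sup>n\<close> and the claim is a polynomial identity.\<close>
    define p where "p = qpoch [A] q n * qpoch [B] q n / qpoch [q] q n * qpoch_inf [A * B * z * q ^ Suc n] q * z ^ n"
    have 1: "gauss_term A B z n = (1 - A * B * z * q ^ n) * p"
      using qpoch_inf_step[of "A * B * z * q ^ n"]
      by (simp add: gauss_term_def p_def mult_ac)
    have 2: "gauss_term A B (q * z) n = q ^ n * p"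
      by (simp add: gauss_term_def p_def power_mult_distrib mult_ac)
    have 3: "(1 - q ^ Suc n) * gauss_term A B z (Suc n) = (1 - A * q ^ n) * (1 - B * q ^ n) * z * p"
      using q_power_neq_1[of n] qpoch_q_nonzero[of n]
      by (simp add: gauss_term_def p_def qpoch_Suc divide_simps) (simp add: mult_ac)
    show ?thesis unfolding G minus_mult_left[symmetric] 3 unfolding 1 2 by (simp add: algebra_simps)
  qed
  have "gauss_term A B z \<longlonglongrightarrow> 0"
    using summable_LIMSEQ_zero[OF summable_norm_cancel[OF gauss_term_summable[OF z]]] .
  hence "G \<longlonglongrightarrow> - (1 - 0) * 0"
    unfolding G using q_lt_1 by (intro tendsto_intros LIMSEQ_power_zero) auto
  hence "(\<lambda>n. G (Suc n) - G n) sums (0 - G 0)"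
    by (intro telescope_sums) auto
  hence "(\<lambda>n. G (Suc n) - G n) sums 0" by (simp add: G)
  moreover have "(\<lambda>n. (1 - z) * gauss_term A B z n - (1 - A * z) * (1 - B * z) * gauss_term A B (q * z) n)
      sums ((1 - z) * (\<Sum>n. gauss_term A B z n) - (1 - A * z) * (1 - B * z) * (\<Sum>n. gauss_term A B (q * z) n))"
    by (intro sums_diff sums_mult summable_sums
        summable_norm_cancel[OF gauss_term_summable[OF z]] summable_norm_cancel[OF gauss_term_summable[OF qz]])
  ultimately have "(1 - z) * (\<Sum>n. gauss_term A B z n)
      - (1 - A * z) * (1 - B * z) * (\<Sum>n. gauss_term A B (q * z) n) = 0"
    unfolding step by (intro sums_unique2)
  thus ?thesis by simp
qed

text \<open>
  Iterating the difference equation moves the argument to \<open>z q\<^sup>N \<rightarrow> 0\<close>, where the sum tends to \<open>1\<close>,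
  while the accumulated factors become infinite products. This argument covers every \<open>A\<close> and \<open>B\<close>
  directly, without the analytic continuation that a derivation from Heine's transformation needs.
\<close>
lemma q_gauss:
  assumes z: "norm z < 1"
  shows "qpoch_inf [z] q * (\<Sum>n. gauss_term A B z n) = qpoch_inf [A * z] q * qpoch_inf [B * z] q"
proof (rule LIMSEQ_unique)
  let ?F = "\<lambda>z. \<Sum>n. gauss_term A B z n"
  have iter: "qpoch [z] q N * ?F z = qpoch [A * z] q N * qpoch [B * z] q N * ?F (z * q ^ N)" for N
  proof (induction N)
    case (Suc N)
    have "norm (z * q ^ N) < 1" using norm_mult_q_power_le[of z N] z by simp
    note s = gauss_sum_step[OF this, of A B]
    have "qpoch [z] q (Suc N) * ?F z = (1 - z * q ^ N) * (qpoch [z] q N * ?F z)"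
      by (simp add: qpoch_Suc mult_ac)
    also have "\<dots> = qpoch [A * z] q N * qpoch [B * z] q N * ((1 - z * q ^ N) * ?F (z * q ^ N))"
      by (simp add: Suc mult_ac)
    also have "\<dots> = qpoch [A * z] q (Suc N) * qpoch [B * z] q (Suc N) * ?F (z * q ^ Suc N)"
      unfolding s by (simp add: qpoch_Suc mult_ac)
    finally show ?case .
  qed auto
  obtain K where K: "\<And>y n. norm y \<le> norm z \<Longrightarrow> norm (gauss_term A B y n) \<le> K * norm y ^ n"
    using gauss_term_bound[where A = A and B = B and z = z] by metis
  have K0: "0 \<le> K" using order_trans[OF norm_ge_zero K[of z 0]] by simp
  have "(\<lambda>N. ?F (z * q ^ N)) \<longlonglongrightarrow> (\<Sum>n. if n = 0 then 1 else 0)"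
  proof (rule tannerys_theorem[THEN conjunct2, THEN conjunct2])
    show "(\<lambda>N. gauss_term A B (z * q ^ N) n) \<longlonglongrightarrow> (if n = 0 then 1 else 0)" for n
    proof (cases "n = 0")
      case True
      thus ?thesis using qpoch_inf_tendsto_1[of "A * B * z"]
        by (simp add: gauss_term_def mult_ac)
    next
      case False
      have "(\<lambda>N. K * (norm z * norm q ^ N) ^ n) \<longlonglongrightarrow> K * (norm z * 0) ^ n"
        using q_lt_1 by (intro tendsto_intros LIMSEQ_power_zero) auto
      hence "(\<lambda>N. K * norm (z * q ^ N) ^ n) \<longlonglongrightarrow> 0"
        using False by (simp add: norm_mult norm_power power_0_left)
      hence "(\<lambda>N. gauss_term A B (z * q ^ N) n) \<longlonglongrightarrow> 0"
        by (rule Lim_null_comparison[OF always_eventually, rotated]) 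
           (auto intro: K norm_mult_q_power_le)
      thus ?thesis using False by simp
    qed
    have "norm (gauss_term A B (z * q ^ N) n) \<le> K * norm z ^ n" for n N
      by (rule order_trans[OF K]) (auto intro!: mult_left_mono power_mono norm_mult_q_power_le K0)
    thus "\<forall>\<^sub>F (n, N) in at_top \<times>\<^sub>F sequentially. norm (gauss_term A B (z * q ^ N) n) \<le> K * norm z ^ n"
      by (intro always_eventually) auto
    show "summable (\<lambda>n. K * norm z ^ n)"
      using z by (intro summable_mult summable_geometric) auto
  qed auto
  also have "(\<Sum>n. if n = 0 then 1 else 0) = (1::complex)"
    using suminf_finite[of "{0::nat}" "\<lambda>n. if n = 0 then 1 else (0::complex)"] by simp
  finally have lim: "(\<lambda>N. ?F (z * q ^ N)) \<longlonglongrightarrow> 1" .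
  show "(\<lambda>N. qpoch [z] q N * ?F z) \<longlonglongrightarrow> qpoch_inf [z] q * ?F z"
    by (intro tendsto_intros qpoch_tendsto)
  have "(\<lambda>N. qpoch [A * z] q N * qpoch [B * z] q N * ?F (z * q ^ N))
     \<longlonglongrightarrow> qpoch_inf [A * z] q * qpoch_inf [B * z] q * 1"
    by (intro tendsto_intros qpoch_tendsto lim)
  thus "(\<lambda>N. qpoch [z] q N * ?F z) \<longlonglongrightarrow> qpoch_inf [A * z] q * qpoch_inf [B * z] q"
    unfolding iter by simp
qed

section \<open>The Saalschuetz sum from a q-difference equation\<close>

text \<open>The dilation \<open>F(X) \<mapsto> F(q X)\<close>, in terms of which \<open>q\<close>-difference equations are written.\<close>
definition q_dilate :: "complex fps \<Rightarrow> complex fps" where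
  "q_dilate F = fps_compose F (fps_const q * fps_X)"

lemma q_dilate_nth [simp]: "fps_nth (q_dilate F) n = q ^ n * fps_nth F n"
  by (simp add: q_dilate_def)

lemma q_dilate_mult: "q_dilate (F * G) = q_dilate F * q_dilate G"
  by (simp add: q_dilate_def fps_compose_mult_distrib)

lemma q_dilate_diff: "q_dilate (F - G) = q_dilate F - q_dilate G"
  by (rule fps_ext) (simp add: algebra_simps)

lemma q_dilate_X: "q_dilate (fps_const c * fps_X) = fps_const (c * q) * fps_X"
  by (rule fps_ext) (simp add: fps_X_def)

lemma q_dilate_1: "q_dilate 1 = 1"
  by (rule fps_ext) simp

text \<open>
  The \<open>q\<close>-Pfaff-Saalschuetz sum in convolution form: it compares coefficients in Euler's transformation
  \<open>\<^sub>2\<phi>\<^sub>1(b, c; d; X) = (\<Sum>m. (u; q)\<^sub>m / (q; q)\<^sub>m \<cdot> X\<^sup>m) \<cdot> \<^sub>2\<phi>\<^sub>1(B, C; d; u X)\<close> with \<open>b = u C\<close>, \<open>c = u B\<close>,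
  \<open>d = u B C\<close>. Parametrising by \<open>u, B, C\<close> instead of \<open>b, c, d\<close> avoids the quotients \<open>d / b\<close> and \<open>d / c\<close>.

  The two factors on the right satisfy a first-order and a second-order \<open>q\<close>-difference equation.
  Their product therefore satisfies a second-order equation, and this is the one whose coefficient
  recursion determines \<open>\<^sub>2\<phi>\<^sub>1(b, c; d; X)\<close>. Working with formal power series removes all convergence
  conditions.
\<close>
lemma q_saalschuetz:
  assumes d: "d = u * B * C" and d_nz: "\<And>n. qpoch [d] q n \<noteq> 0"
  shows "(\<Sum>k\<le>n. qpoch [B] q k * qpoch [C] q k / (qpoch [q] q k * qpoch [d] q k) * u ^ k
                   * (qpoch [u] q (n - k) / qpoch [q] q (n - k)))
       = qpoch [u * B] q n * qpoch [u * C] q n / (qpoch [q] q n * qpoch [d] q n)"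
proof -
  have d_nz': "1 - q ^ n * d \<noteq> 0" for n using d_nz[of "Suc n"] by (simp add: qpoch_Suc)
  define H where "H = Abs_fps (\<lambda>n. qpoch [u] q n / qpoch [q] q n)"
  define \<Phi> where "\<Phi> = Abs_fps (\<lambda>n. qpoch [B] q n * qpoch [C] q n / (qpoch [q] q n * qpoch [d] q n) * u ^ n)"
  define G where "G = \<Phi> * H"
  let ?T = q_dilate and ?c = fps_const and ?X = "fps_X :: complex fps"
  have H: "(1 - ?X) * H = (1 - ?c u * ?X) * ?T H"
  proof (rule fps_ext)
    fix n
    show "fps_nth ((1 - ?X) * H) n = fps_nth ((1 - ?c u * ?X) * ?T H) n"
    proof (cases n)
      case (Suc m)
      show ?thesis using q_power_neq_1[of m] qpoch_q_nonzero[of m]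
        by (simp add: Suc left_diff_distrib mult.assoc H_def qpoch_Suc divide_simps) (simp add: algebra_simps)
    qed (simp add: left_diff_distrib mult.assoc H_def)
  qed
  have TH: "(1 - ?c q * ?X) * ?T H = (1 - ?c (u * q) * ?X) * ?T (?T H)"
    using arg_cong[OF H, of ?T] q_dilate_X[of 1] q_dilate_X[of u]
    by (simp add: q_dilate_mult q_dilate_diff q_dilate_1)
  have \<Phi>: "?c q * (1 - ?c u * ?X) * \<Phi> - (?c (q + d) - ?c (q * u * (B + C)) * ?X) * ?T \<Phi>
      + ?c d * (1 - ?c q * ?X) * ?T (?T \<Phi>) = 0"
  proof (rule fps_ext)
    fix n
    show "fps_nth (?c q * (1 - ?c u * ?X) * \<Phi> - (?c (q + d) - ?c (q * u * (B + C)) * ?X) * ?T \<Phi>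
      + ?c d * (1 - ?c q * ?X) * ?T (?T \<Phi>)) n = fps_nth 0 n"
    proof (cases n)
      case (Suc m)
      \<comment> \<open>In terms of \<open>p\<close>, the coefficient recursion of \<open>\<Phi>\<close> is free of denominators.\<close>
      define p where "p = qpoch [B] q m * qpoch [C] q m / (qpoch [q] q m * qpoch [d] q m) * u ^ m"
      have 1: "fps_nth \<Phi> m = p" by (simp add: \<Phi>_def p_def)
      have 2: "(1 - q * q ^ m) * (1 - q ^ m * d) * fps_nth \<Phi> (Suc m) = u * (1 - q ^ m * B) * (1 - q ^ m * C) * p"
        using q_power_neq_1[of m] d_nz'[of m] qpoch_q_nonzero[of m] d_nz[of m]
        by (simp add: \<Phi>_def p_def qpoch_Suc divide_simps) (simp add: algebra_simps)
      have "fps_nth (?c q * (1 - ?c u * ?X) * \<Phi> - (?c (q + d) - ?c (q * u * (B + C)) * ?X) * ?T \<Phi>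
      + ?c d * (1 - ?c q * ?X) * ?T (?T \<Phi>)) n
        = q * ((1 - q * q ^ m) * (1 - q ^ m * d) * fps_nth \<Phi> (Suc m))
           - q * u * p + q * u * (B + C) * q ^ m * p - d * q * (q ^ m * q ^ m) * p"
        by (simp add: Suc left_diff_distrib right_diff_distrib mult.assoc 1) (simp add: algebra_simps)
      also have "\<dots> = 0" unfolding 2 unfolding d by (simp add: algebra_simps)
      finally show ?thesis by simp
    qed (simp add: left_diff_distrib right_diff_distrib mult.assoc, simp add: algebra_simps)
  qed
  \<comment> \<open>\<open>H\<close> and \<open>?T (?T H)\<close> occur with exactly the coefficients for which the equations of \<open>H\<close> make them
      multiples of \<open>?T H\<close>; after taking out \<open>?T H\<close>, the equation of \<open>\<Phi>\<close> is left.\<close>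
  have "?c q * (1 - ?X) * G - (?c (q + d) - ?c (q * u * (B + C)) * ?X) * ?T G
      + ?c d * (1 - ?c (u * q) * ?X) * ?T (?T G)
    = ?c q * \<Phi> * ((1 - ?X) * H) - (?c (q + d) - ?c (q * u * (B + C)) * ?X) * ?T \<Phi> * ?T H
      + ?c d * ?T (?T \<Phi>) * ((1 - ?c (u * q) * ?X) * ?T (?T H))"
    unfolding G_def q_dilate_mult by (simp only: mult_ac)
  also have "\<dots> = ?T H * (?c q * (1 - ?c u * ?X) * \<Phi> - (?c (q + d) - ?c (q * u * (B + C)) * ?X) * ?T \<Phi>
      + ?c d * (1 - ?c q * ?X) * ?T (?T \<Phi>))"
    unfolding H TH[symmetric] by (simp only: ring_distribs mult_ac)
  also have "\<dots> = 0" unfolding \<Phi> by simp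
  finally have G: "?c q * (1 - ?X) * G - (?c (q + d) - ?c (q * u * (B + C)) * ?X) * ?T G
      + ?c d * (1 - ?c (u * q) * ?X) * ?T (?T G) = 0" .
  have step: "(1 - q * q ^ m) * (1 - q ^ m * d) * fps_nth G (Suc m)
      = (1 - q ^ m * (u * B)) * (1 - q ^ m * (u * C)) * fps_nth G m" for m
  proof -
    \<comment> \<open>The factor \<open>q\<close> comes from clearing the denominator of \<open>d / q\<close> in the \<open>q\<close>-difference equation.\<close>
    have "q * ((1 - q * q ^ m) * (1 - q ^ m * d) * fps_nth G (Suc m)
        - (1 - q ^ m * (u * B)) * (1 - q ^ m * (u * C)) * fps_nth G m) = 
      fps_nth (?c q * (1 - ?X) * G - (?c (q + d) - ?c (q * u * (B + C)) * ?X) * ?T G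
      + ?c d * (1 - ?c (u * q) * ?X) * ?T (?T G)) (Suc m)"
      by (simp add: left_diff_distrib right_diff_distrib mult.assoc) (simp add: algebra_simps d)
    thus ?thesis unfolding G using q_nonzero by simp
  qed
  have "fps_nth G n = qpoch [u * B] q n * qpoch [u * C] q n / (qpoch [q] q n * qpoch [d] q n)"
  proof (induction n)
    case 0
    show ?case by (simp add: G_def \<Phi>_def H_def)
  next
    case (Suc m)
    show ?case using step[of m] q_power_neq_1[of m] d_nz'[of m] qpoch_q_nonzero[of m] d_nz[of m]
      by (simp add: qpoch_Suc Suc divide_simps) (simp add: mult_ac)
  qed
  thus ?thesis by (simp add: G_def fps_mult_nth \<Phi>_def H_def atLeast0AtMost)
qed

end

section \<open>Transformation of a 3phi2 series\<close>

lemma double_suminf_diagonal: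
  fixes f :: "nat \<Rightarrow> nat \<Rightarrow> complex"
  assumes bound: "\<And>k m. norm (f k m) \<le> K * r ^ k * s ^ m"
    and r: "0 \<le> r" "r < 1" and s: "0 \<le> s" "s < 1"
  obtains S where "(\<lambda>k. \<Sum>m. f k m) sums S" "(\<lambda>n. \<Sum>k\<le>n. f k (n - k)) sums S"
proof -
  have geo: "((\<lambda>n. t ^ n) has_sum 1 / (1 - t)) UNIV" if "0 \<le> t" "t < 1" for t :: real
    using that by (intro sums_nonneg_imp_has_sum geometric_sums) auto
  have "(\<lambda>(k, m). K * r ^ k * s ^ m) summable_on UNIV \<times> UNIV"
  proof -
    have "(\<lambda>(k, m). r ^ k * s ^ m) summable_on UNIV \<times> UNIV"
    proof (rule summable_on_SigmaI)
      show "((\<lambda>m. case (k, m) of (k, m) \<Rightarrow> r ^ k * s ^ m) has_sum r ^ k * (1 / (1 - s))) UNIV" for k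
        using has_sum_cmult_right[OF geo[OF s], of "r ^ k"] by simp
      show "(\<lambda>k. r ^ k * (1 / (1 - s))) summable_on UNIV"
        by (intro summable_on_cmult_left has_sum_imp_summable[OF geo[OF r]])
    qed (use r s in auto)
    from summable_on_cmult_right[OF this, of K] show ?thesis
      by (simp add: case_prod_unfold mult.assoc)
  qed
  hence "(\<lambda>p. norm (case p of (k, m) \<Rightarrow> f k m)) summable_on UNIV \<times> UNIV"
    by (rule summable_on_comparison_test) (use bound in auto)
  hence f: "(\<lambda>(k, m). f k m) summable_on UNIV \<times> UNIV"
    by (rule abs_summable_summable)
  then obtain S where S: "((\<lambda>(k, m). f k m) has_sum S) (UNIV \<times> UNIV)"
    by (auto simp: summable_on_def)
  have row: "f k summable_on UNIV" for k
    using summable_on_SigmaD1[OF f, of k] by simp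
  have row_eq: "infsum (f k) UNIV = (\<Sum>m. f k m)" for k
    using has_sum_imp_sums[OF has_sum_infsum[OF row]] by (simp add: sums_iff)
  show thesis
  proof (rule that; rule has_sum_imp_sums)
    show "((\<lambda>k. \<Sum>m. f k m) has_sum S) UNIV"
      by (rule has_sum_SigmaD[OF S]) (use has_sum_infsum[OF row] row_eq in auto)
    have "((\<lambda>(n, k). f k (n - k)) has_sum S) (SIGMA n:UNIV. {..n})
        \<longleftrightarrow> ((\<lambda>(k, m). f k m) has_sum S) (UNIV \<times> UNIV)"
      by (rule has_sum_reindex_bij_witness[of _ "\<lambda>(k, m). (k + m, k)" "\<lambda>(n, k). (k, n - k)"]) auto
    with S have "((\<lambda>(n, k). f k (n - k)) has_sum S) (SIGMA n:UNIV. {..n})" by simp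
    thus "((\<lambda>n. \<Sum>k\<le>n. f k (n - k)) has_sum S) UNIV"
      by (rule has_sum_SigmaD) (auto intro!: has_sum_finiteI)
  qed
qed

context q_in_punctured_disc begin

text \<open>
  Both series come from one absolutely convergent double series \<open>f\<close>. On the diagonal \<open>k + m = n\<close> the
  factors depending on \<open>n\<close> alone can be taken out, and the rest is a Saalschuetz sum, which gives the
  series in \<open>z\<close>. For fixed \<open>k\<close> the sum over \<open>m\<close> is a Gauss sum with parameters \<open>a q\<^sup>k\<close> and \<open>u\<close>,
  which gives the series in \<open>w\<close>.

  In classical notation the transformation is
  \<open>\<^sub>3\<phi>\<^sub>2(a, b, c; d, e; de/abc) = (e/a, de/bc; q)\<^sub>\<infinity> / (e, de/abc; q)\<^sub>\<infinity> \<cdot> \<^sub>3\<phi>\<^sub>2(a, d/b, d/c; d, de/bc; e/a)\<close>,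
  with \<open>B = d/b\<close>, \<open>C = d/c\<close>, \<open>u = bc/d\<close>, \<open>z = de/abc\<close>, \<open>w = e/a\<close> and \<open>g = de/bc\<close>.
\<close>
lemma phi32_transformation:
  assumes z: "norm z < 1" and w: "norm w < 1" and d_nz: "\<And>n. qpoch [d] q n \<noteq> 0"
    and e_nz: "\<And>n. qpoch [e] q n \<noteq> 0" and g_nz: "\<And>n. qpoch [g] q n \<noteq> 0"
    and params: "d = u * B * C" "b = u * C" "c = u * B" "w = u * z" "e = a * w" "g = a * z"
  shows "qpoch_inf [z] q * qpoch_inf [e] q * phi32 a b c e d q z
       = qpoch_inf [w] q * qpoch_inf [g] q * phi32 B C a d g q w"
proof -
  let ?P = "\<lambda>a n. qpoch [a] q n" and ?I = "\<lambda>a. qpoch_inf [a] q"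
  define \<phi> where "\<phi> k = ?P B k * ?P C k / (?P q k * ?P d k)" for k
  define h where "h m = ?P u m / ?P q m" for m
  define f where "f k m = ?P a (k + m) * ?I (e * q ^ (k + m)) * \<phi> k * h m * w ^ k * z ^ m" for k m
  obtain Kq where Kq: "\<And>n. norm (inverse (?P q n)) \<le> Kq" "0 < Kq"
    using inverse_qpoch_bounded[OF qpoch_q_nonzero] by blast
  obtain Kd where Kd: "\<And>n. norm (inverse (?P d n)) \<le> Kd" "0 < Kd"
    using inverse_qpoch_bounded[OF d_nz] by blast
  define E where "E a = exp (norm a / (1 - norm q))" for a :: complex
  have E: "0 \<le> E a" "norm (?P a n) \<le> E a" "norm (?I (a * q ^ n)) \<le> E a" for a n
    unfolding E_def by (auto intro!: norm_qpoch_le norm_qpoch_inf_le norm_mult_q_power_le)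
  have bound: "norm (f k m) \<le> (E a * E e * (E B * E C * (Kq * Kd)) * (E u * Kq)) * norm w ^ k * norm z ^ m" for k m
  proof -
    have 1: "norm (\<phi> k) \<le> E B * E C * (Kq * Kd)"
      unfolding \<phi>_def divide_inverse inverse_mult_distrib norm_mult
      by (intro mult_mono E Kq(1) Kd(1) mult_nonneg_nonneg norm_ge_zero less_imp_le[OF Kq(2)] less_imp_le[OF Kd(2)])
    have 2: "norm (h m) \<le> E u * Kq"
      unfolding h_def divide_inverse norm_mult
      by (intro mult_mono E Kq(1) mult_nonneg_nonneg norm_ge_zero)
    show ?thesis unfolding f_def norm_mult norm_power
      by (intro mult_mono E 1 2 order_refl mult_nonneg_nonneg norm_ge_zero zero_le_power less_imp_le[OF Kq(2)] less_imp_le[OF Kd(2)])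
  qed
  have diag: "(\<Sum>k\<le>n. f k (n - k)) = ?I e * (qpoch [a, b, c] q n / (?P q n * qpoch [e, d] q n) * z ^ n)" for n
  proof -
    have "(\<Sum>k\<le>n. f k (n - k)) = (\<Sum>k\<le>n. ?P a n * ?I (e * q ^ n) * z ^ n * (\<phi> k * u ^ k * h (n - k)))"
    proof (rule sum.cong)
      fix k assume "k \<in> {..n}"
      hence n: "k + (n - k) = n" "z ^ n = z ^ k * z ^ (n - k)" by (auto simp flip: power_add)
      show "f k (n - k) = ?P a n * ?I (e * q ^ n) * z ^ n * (\<phi> k * u ^ k * h (n - k))"
        unfolding f_def n params(4) power_mult_distrib by (simp only: mult_ac)
    qed auto
    also have "\<dots> = ?P a n * ?I (e * q ^ n) * z ^ n * (?P (u * B) n * ?P (u * C) n / (?P q n * ?P d n))"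
      unfolding sum_distrib_left[symmetric] \<phi>_def h_def
      using q_saalschuetz[OF params(1) d_nz] by (simp only:)
    also have "\<dots> = ?I e * (qpoch [a, b, c] q n / (?P q n * qpoch [e, d] q n) * z ^ n)"
      unfolding qpoch_inf_split[of e n] qpoch_Cons params(2,3)
      using e_nz[of n] d_nz[of n] qpoch_q_nonzero[of n] by (simp add: divide_simps)
    finally show ?thesis .
  qed
  have row: "?I z * (\<Sum>m. f k m) = ?I w * ?I g * (qpoch [B, C, a] q k / (?P q k * qpoch [d, g] q k) * w ^ k)" for k
  proof -
    have gauss: "f k m = ?P a k * \<phi> k * w ^ k * gauss_term (a * q ^ k) u z m" for m
      by (simp add: f_def gauss_term_def h_def qpoch_add params(4,5) power_add mult_ac)
    have "?I z * (\<Sum>m. f k m) = ?P a k * \<phi> k * w ^ k * (?I z * (\<Sum>m. gauss_term (a * q ^ k) u z m))"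
      unfolding gauss suminf_mult[OF summable_norm_cancel[OF gauss_term_summable[OF z]]]
      by (simp only: mult_ac)
    also have "\<dots> = ?P a k * \<phi> k * w ^ k * (?I (g * q ^ k) * ?I w)"
      unfolding q_gauss[OF z] by (simp add: params mult_ac)
    also have "\<dots> = ?I w * ?I g * (qpoch [B, C, a] q k / (?P q k * qpoch [d, g] q k) * w ^ k)"
      unfolding qpoch_inf_split[of g k] qpoch_Cons \<phi>_def
      using g_nz[of k] d_nz[of k] qpoch_q_nonzero[of k] by (simp add: divide_simps)
    finally show ?thesis .
  qed
  obtain S where S: "(\<lambda>k. \<Sum>m. f k m) sums S" "(\<lambda>n. \<Sum>k\<le>n. f k (n - k)) sums S"
    by (rule double_suminf_diagonal[OF bound]) (use z w in auto)
  have "?I e * phi32 a b c e d q z = S"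
    using sums_mult_D[OF S(2)[unfolded diag] qpoch_inf_nonzero[OF e_nz]] qpoch_inf_nonzero[OF e_nz]
    by (simp add: phi32_def sums_iff)
  moreover have "?I w * ?I g * phi32 B C a d g q w = ?I z * S"
  proof -
    have nz: "?I w * ?I g \<noteq> 0"
      using qpoch_inf_nonzero[OF qpoch_nonzero[OF w]] qpoch_inf_nonzero[OF g_nz] by simp
    show ?thesis
      using sums_mult_D[OF sums_mult[OF S(1), of "?I z", unfolded row] nz] nz
      by (simp add: phi32_def sums_iff)
  qed
  ultimately show ?thesis by (simp add: mult.assoc)
qed

section \<open>Theta functions and the connection formula\<close>

text \<open>
  Shifting one factor from \<open>(s; q)\<^sub>\<infinity>\<close> to \<open>(q/s; q)\<^sub>\<infinity>\<close>: the price is \<open>(1 - s) / (1 - 1/s) = -s\<close>.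
  The products \<open>(q s; q)\<^sub>\<infinity>\<close> and \<open>(1/s; q)\<^sub>\<infinity>\<close> are those occurring in \<open>A\<^sub>1\<^sub>,\<^sub>2\<close> and \<open>S\<^sub>1\<close>.
\<close>
lemma qtheta_eq:
  assumes "s \<noteq> 0"
  shows "qtheta q s = - s * qpoch_inf [q * s] q * qpoch_inf [1 / s] q * qpoch_inf [q] q"
proof -
  have 1: "(1 - s) * qpoch_inf [q / s] q = - s * qpoch_inf [1 / s] q"
    using assms qpoch_inf_step[of "1 / s"] by (simp add: field_simps)
  have "qtheta q s = ((1 - s) * qpoch_inf [q / s] q) * qpoch_inf [q * s] q * qpoch_inf [q] q"
    using qpoch_inf_step[of s] by (simp add: qtheta_def qpoch_inf_Cons)
  thus ?thesis unfolding 1 by simp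
qed

lemma qtheta_inverse:
  assumes "s \<noteq> 0"
  shows "s * qtheta q (1 / s) = - qtheta q s"
  using qtheta_eq[OF assms] by (simp add: qtheta_def qpoch_inf_Cons mult_ac)

end

theorem proposition3p4:
  fixes q lq \<alpha>1 \<alpha>2 \<beta>1 \<beta>2 lb1 lb2 lam mu' x lx :: complex
  assumes q: "0 < norm q" "norm q < 1"
    and nonzero: "\<alpha>1 \<noteq> 0" "\<alpha>2 \<noteq> 0" "\<beta>1 \<noteq> 0" "\<beta>2 \<noteq> 0" "x \<noteq> 0"
    and logs: "exp lq = q" "exp lb1 = \<beta>1" "exp lb2 = \<beta>2" "exp lx = x"
    and balance: "lpow lq mu' * \<alpha>1 * \<alpha>2 / (\<beta>1 * \<beta>2) = 1"
    and convergence: "norm (lpow lq lam * \<alpha>1 * \<alpha>2 / (\<beta>1 * \<beta>2)) < 1" "norm (\<alpha>2 / \<beta>1) < 1"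
    and generic_y_b1:
      "qpoch_inf [lpow lq (-lam) * \<beta>1 * x, \<beta>1 / \<alpha>1, q * \<beta>1 / \<alpha>2] q \<noteq> 0"
      "\<And>n. qpoch [\<beta>1 * x, q * \<beta>1 / \<beta>2] q n \<noteq> 0"
    and generic_y_b2:
      "qpoch_inf [lpow lq (-lam) * \<beta>2 * x, \<beta>2 / \<alpha>1, q * \<beta>2 / \<alpha>2] q \<noteq> 0"
      "\<And>n. qpoch [\<beta>2 * x, q * \<beta>2 / \<beta>1] q n \<noteq> 0"
    and generic_f33:
      "qpoch_inf [lpow lq (-lam) * \<beta>2 * x] q \<noteq> 0"
      "\<And>n. qpoch [lpow lq (lam + 1) * \<alpha>1 / \<beta>1, \<beta>2 * x] q n \<noteq> 0"
    and generic_A11: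
      "qpoch_inf [lpow lq lam * \<alpha>2 / \<beta>2, \<beta>2 / \<alpha>1, lpow lq (-lam) * \<beta>1 / \<alpha>1] q \<noteq> 0"
      "A11 q lq \<alpha>1 \<alpha>2 \<beta>1 \<beta>2 lam \<noteq> 0"
    and generic_A12:
      "qpoch_inf [lpow lq lam * \<alpha>2 / \<beta>2, \<alpha>2 / \<beta>1, lpow lq (-lam) * \<beta>1 / \<alpha>1,
                  lpow lq (lam + 1) * \<alpha>1 / \<beta>1, q] q \<noteq> 0"
    and generic_K63:
      "qtheta q (\<beta>2 / \<beta>1) * qtheta q (\<alpha>2 / \<beta>2) * qtheta q (lpow lq lam * \<alpha>1 / \<beta>2) \<noteq> 0"
    and generic_S1:
      "qpoch_inf [lpow lq (lam + 1) * \<alpha>1 / \<beta>2, lpow lq lam * \<alpha>2 / \<beta>2, q] q \<noteq> 0"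
  shows "f33 q lq \<alpha>1 \<alpha>2 \<beta>1 \<beta>2 lam x lx =
    (S1_check q lq \<alpha>1 \<alpha>2 \<beta>1 \<beta>2 lb1 lam mu'
      + A12 q lq \<alpha>1 \<alpha>2 \<beta>1 \<beta>2 lb2 lam mu' * K63 q lq \<alpha>1 \<alpha>2 \<beta>1 \<beta>2 lb1 lb2 lam mu')
        / A11 q lq \<alpha>1 \<alpha>2 \<beta>1 \<beta>2 lam
      * y_b1 q lq \<alpha>1 \<alpha>2 \<beta>1 \<beta>2 lb1 lam mu' x lx
    - A12 q lq \<alpha>1 \<alpha>2 \<beta>1 \<beta>2 lb2 lam mu' / A11 q lq \<alpha>1 \<alpha>2 \<beta>1 \<beta>2 lam
      * y_b2 q lq \<alpha>1 \<alpha>2 \<beta>1 \<beta>2 lb2 lam mu' x lx"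
proof -
  interpret q_in_punctured_disc q using q by unfold_locales
  let ?I = "\<lambda>a. qpoch_inf [a] q"
  define Q where "Q = lpow lq lam"
  have Q_nz: "Q \<noteq> 0" by (simp add: Q_def lpow_def)
  have Qm: "lpow lq (-lam) = 1 / Q" and Q1: "lpow lq (lam + 1) = q * Q"
    using logs by (simp_all add: Q_def lpow_def exp_minus exp_add ring_distribs field_simps)
  define L1 L2 where "L1 = lpow lb1 (lam - mu')" and "L2 = lpow lb2 (lam - mu')"
  have L_nz: "L1 \<noteq> 0" "L2 \<noteq> 0" by (simp_all add: L1_def L2_def lpow_def)
  have Lm: "lpow lb1 (-lam + mu') = 1 / L1" "lpow lb2 (-lam + mu') = 1 / L2"
    by (simp_all add: L1_def L2_def lpow_def field_simps flip: exp_add)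
  define Z where "Z = Q * \<alpha>1 * \<alpha>2 / (\<beta>1 * \<beta>2)"
  have Z': "Q * (\<alpha>1 * \<alpha>2 / (\<beta>1 * \<beta>2)) = Z" by (simp add: Z_def)
  \<comment> \<open>The products of \<open>q s\<close> and \<open>1/s\<close> in the coefficients are the two halves of \<open>\<vartheta>(s)\<close>.\<close>
  define s1 s2 where "s1 = Q * \<alpha>1 / \<beta>1" and "s2 = Q * \<alpha>1 / \<beta>2"
  have s_nz: "s1 \<noteq> 0" "s2 \<noteq> 0" using Q_nz nonzero by (simp_all add: s1_def s2_def)
  have s': "1 / Q * \<beta>1 / \<alpha>1 = 1 / s1" "1 / Q * \<beta>2 / \<alpha>1 = 1 / s2"
    "q * Q * \<alpha>1 / \<beta>1 = q * s1" "q * Q * \<alpha>1 / \<beta>2 = q * s2"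
    by (simp_all add: s1_def s2_def)
  have q1: "1 - q \<noteq> 0" using q by auto
  note nz = generic_A12 generic_A11 generic_K63 generic_S1
  note [simp] = qpoch_inf_Cons
  have th: "qtheta q (\<alpha>2 / \<beta>1) = ?I (\<alpha>2 / \<beta>1) * ?I (q * \<beta>1 / \<alpha>2) * ?I q"
    "qtheta q (\<alpha>2 / \<beta>2) = ?I (\<alpha>2 / \<beta>2) * ?I (q * \<beta>2 / \<alpha>2) * ?I q"
    by (simp_all add: qtheta_def)
  have th12: "\<beta>2 * qtheta q (\<beta>1 / \<beta>2) = - \<beta>1 * qtheta q (\<beta>2 / \<beta>1)"
    using qtheta_inverse[of "\<beta>2 / \<beta>1"] nonzero by (simp add: field_simps)
  have t_nz: "qtheta q (\<beta>2 / \<beta>1) \<noteq> 0" using generic_K63 by auto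
  have K63: "K63 q lq \<alpha>1 \<alpha>2 \<beta>1 \<beta>2 lb1 lb2 lam mu' = L2 / L1 *
     (?I (\<alpha>2 / \<beta>1) * ?I (q * \<beta>1 / \<alpha>2) * ?I (q * s1) * ?I (1 / s1)
       / (?I (\<alpha>2 / \<beta>2) * ?I (q * \<beta>2 / \<alpha>2) * ?I (q * s2) * ?I (1 / s2)))"
  proof -
    have 1: "qtheta q (\<beta>1 / \<beta>2) / qtheta q (\<beta>2 / \<beta>1) = - \<beta>1 / \<beta>2"
      using th12 t_nz nonzero by (simp add: field_simps)
    have 2: "s1 / s2 = \<beta>2 / \<beta>1" using Q_nz nonzero by (simp add: s1_def s2_def)
    have "K63 q lq \<alpha>1 \<alpha>2 \<beta>1 \<beta>2 lb1 lb2 lam mu' = - (L2 / L1) * 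
      ((qtheta q (\<beta>1 / \<beta>2) / qtheta q (\<beta>2 / \<beta>1)) * (qtheta q (\<alpha>2 / \<beta>1) / qtheta q (\<alpha>2 / \<beta>2))
        * (qtheta q s1 / qtheta q s2))"
      by (simp add: K63_def L1_def L2_def Q_def s1_def s2_def)
    also have "\<dots> = (L2 / L1) * (qtheta q (\<alpha>2 / \<beta>1) / qtheta q (\<alpha>2 / \<beta>2))
        * (\<beta>1 / \<beta>2 * (s1 / s2)) * ((?I (q * s1) * ?I (1 / s1) * ?I q) / (?I (q * s2) * ?I (1 / s2) * ?I q))"
      unfolding 1 qtheta_eq[OF s_nz(1)] qtheta_eq[OF s_nz(2)] by (simp add: mult_ac)
    also have "\<beta>1 / \<beta>2 * (s1 / s2) = 1" unfolding 2 using nonzero by simp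
    finally show ?thesis unfolding th using nz by (simp add: mult_ac)
  qed
  have A11: "A11 q lq \<alpha>1 \<alpha>2 \<beta>1 \<beta>2 lam = ?I (\<beta>1 / \<alpha>1) * ?I (\<alpha>2 / \<beta>2) * ?I (1 / s2)
      / (?I (Q * \<alpha>2 / \<beta>2) * ?I (\<beta>2 / \<alpha>1) * ?I (1 / s1))"
    unfolding A11_def Qm Q_def[symmetric] s' by (simp add: mult_ac)
  have A12: "A12 q lq \<alpha>1 \<alpha>2 \<beta>1 \<beta>2 lb2 lam mu' = - (1 / L2 / (1 - q))
      * (?I (1 / s2) * ?I Z * ?I (q * \<beta>2 / \<alpha>2) * ?I (\<beta>1 / \<alpha>1) * ?I (\<alpha>2 / \<beta>2)
        / (?I (Q * \<alpha>2 / \<beta>2) * ?I (\<alpha>2 / \<beta>1) * ?I (1 / s1) * ?I (q * s1) * ?I q))"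
    unfolding A12_def Qm Q1 Q_def[symmetric] s' Lm Z_def[symmetric] by (simp add: mult_ac)
  have S1: "S1_check q lq \<alpha>1 \<alpha>2 \<beta>1 \<beta>2 lb1 lam mu' = 1 / L1 / (1 - q)
      * (?I Z * ?I (\<beta>1 / \<alpha>1) * ?I (q * \<beta>1 / \<alpha>2) / (?I (q * s2) * ?I (Q * \<alpha>2 / \<beta>2) * ?I q))"
    unfolding S1_check_def Q1 Q_def[symmetric] s' Lm Z_def[symmetric] by (simp add: mult_ac)
  have nz': "?I q \<noteq> 0" "?I (\<alpha>2 / \<beta>1) \<noteq> 0" "?I (q * s1) \<noteq> 0" "?I (q * s2) \<noteq> 0" "?I (1 / s1) \<noteq> 0"
    "?I (1 / s2) \<noteq> 0" "?I (Q * \<alpha>2 / \<beta>2) \<noteq> 0" "?I (\<beta>2 / \<alpha>1) \<noteq> 0" "?I (\<beta>1 / \<alpha>1) \<noteq> 0"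
    "?I (\<alpha>2 / \<beta>2) \<noteq> 0" "?I (q * \<beta>2 / \<alpha>2) \<noteq> 0" "?I (1 / Q * \<beta>2 * x) \<noteq> 0"
    using generic_A12 generic_A11(2) generic_S1 generic_y_b2(1)
    unfolding A11 unfolding Qm Q1 Q_def[symmetric] s' by auto
  have vanish: "S1_check q lq \<alpha>1 \<alpha>2 \<beta>1 \<beta>2 lb1 lam mu'
      + A12 q lq \<alpha>1 \<alpha>2 \<beta>1 \<beta>2 lb2 lam mu' * K63 q lq \<alpha>1 \<alpha>2 \<beta>1 \<beta>2 lb1 lb2 lam mu' = 0"
    unfolding K63 S1 A12 using nz' L_nz q1 by (simp add: field_simps)
  \<comment> \<open>The parameter \<open>u = bc/d\<close> is \<open>q\<^sup>\<lambda> (\<alpha>1 x) / (\<beta>2 x)\<close>, so \<open>x\<close> cancels.\<close>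
  have trans: "?I (\<alpha>2 / \<beta>1) * ?I (q * s1) * phi32 (q * \<beta>2 / \<alpha>2) Q (\<alpha>1 * x) (q * s1) (\<beta>2 * x) q (\<alpha>2 / \<beta>1)
    = ?I Z * ?I (q * \<beta>2 / \<beta>1) * phi32 (1 / Q * \<beta>2 * x) (\<beta>2 / \<alpha>1) (q * \<beta>2 / \<alpha>2) (\<beta>2 * x) (q * \<beta>2 / \<beta>1) q Z"
  proof (rule phi32_transformation[where u = s2])
    show "qpoch [\<beta>2 * x] q n \<noteq> 0" "qpoch [q * \<beta>2 / \<beta>1] q n \<noteq> 0" for n
      using generic_y_b2(2)[of n] by (auto simp: qpoch_Cons)
    show "qpoch [q * s1] q n \<noteq> 0" for n
      using generic_f33(2)[of n] by (auto simp: qpoch_Cons Q1 s')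
  qed (use convergence nonzero Q_nz in \<open>auto simp: Z_def s1_def s2_def Q_def[symmetric]\<close>)
  define X \<phi>f \<phi>y where "X = lpow lx lam"
    and "\<phi>f = phi32 (q * \<beta>2 / \<alpha>2) Q (\<alpha>1 * x) (q * s1) (\<beta>2 * x) q (\<alpha>2 / \<beta>1)"
    and "\<phi>y = phi32 (1 / Q * \<beta>2 * x) (\<beta>2 / \<alpha>1) (q * \<beta>2 / \<alpha>2) (\<beta>2 * x) (q * \<beta>2 / \<beta>1) q Z"
  have f33: "f33 q lq \<alpha>1 \<alpha>2 \<beta>1 \<beta>2 lam x lx = X * (?I (\<beta>2 * x) / ?I (1 / Q * \<beta>2 * x)) * \<phi>f"
    unfolding f33_def Qm Q1 Q_def[symmetric] s' X_def \<phi>f_def by (rule refl)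
  have y_b2: "y_b2 q lq \<alpha>1 \<alpha>2 \<beta>1 \<beta>2 lb2 lam mu' x lx = (1 - q) * L2 * X
      * (?I (\<beta>2 * x) * ?I q * ?I (q * \<beta>2 / \<beta>1)
        / (?I (1 / Q * \<beta>2 * x) * ?I (\<beta>2 / \<alpha>1) * ?I (q * \<beta>2 / \<alpha>2))) * \<phi>y"
    unfolding y_b2_def Qm Q1 Q_def[symmetric] Z' L2_def X_def \<phi>y_def by (simp add: mult_ac)
  have \<phi>f: "\<phi>f = ?I Z * ?I (q * \<beta>2 / \<beta>1) * \<phi>y / (?I (\<alpha>2 / \<beta>1) * ?I (q * s1))"
    using trans nz'(2,3) unfolding \<phi>f_def \<phi>y_def by (simp add: field_simps)
  show ?thesis
    unfolding vanish unfolding A11 A12 f33 y_b2 \<phi>f using nz' L_nz q1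
    by (simp add: divide_simps)
qed

end
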